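(* For every finite simple graph $G$, $\mathrm{gt}(G)\ge \mathrm{gpack}(G)$.
   Context: A geodesic in a graph $G$ is a shortest path between two vertices. A geodesic is maximal if it is not a (proper) subpath of another geodesic of $G$. A set $S\subseteq V(G)$ is a geodesic transversal of $G$ if every maximal geodesic of $G$ contains at least one vertex of $S$. The geodesic transversal number $\mathrm{gt}(G)$ is the minimum cardinality of a geodesic transversal of $G$. A geodesic packing of $G$ is a set of maximal geodesics of $G$ that are mutually vertex-disjoint. The geodesic packing number $\mathrm{gpack}(G)$ is the maximum cardinality of a geodesic packing of $G$. *)

theory Defs
  imports "Graph_Theory.Graph_Theory" "HOL-Library.Sublist"
begin

text \<open>
  A finite simple graph is a \<^term>\<open>graph\<close> of the Graph Theory entry (a finite symmetric
  digraph without loops and parallel arcs). A path is a \<^term>\<open>vpath\<close>, the nonempty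
  list of its distinct consecutive vertices; one-vertex paths are allowed. A list and its
  reversal represent the same undirected path.
\<close>

definition geodesic :: "('a,'b) pre_digraph \<Rightarrow> 'a list \<Rightarrow> bool" where
  "geodesic G p \<longleftrightarrow> vpath p G \<and>
     (\<forall>q. vpath q G \<and> hd q = hd p \<and> last q = last p \<longrightarrow> vwalk_length p \<le> vwalk_length q)"

text \<open>Subpaths are taken up to reversal, so a path is not a proper subpath of its own reversal.\<close>

definition subpath :: "'a list \<Rightarrow> 'a list \<Rightarrow> bool" where
  "subpath p q \<longleftrightarrow> sublist p q \<or> sublist (rev p) q"

definition proper_subpath :: "'a list \<Rightarrow> 'a list \<Rightarrow> bool" where
  "proper_subpath p q \<longleftrightarrow> subpath p q \<and> \<not> subpath q p"

definition maximal_geodesic :: "('a,'b) pre_digraph \<Rightarrow> 'a list \<Rightarrow> bool" where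
  "maximal_geodesic G p \<longleftrightarrow> geodesic G p \<and> \<not> (\<exists>q. geodesic G q \<and> proper_subpath p q)"

definition geodesic_transversal :: "('a,'b) pre_digraph \<Rightarrow> 'a set \<Rightarrow> bool" where
  "geodesic_transversal G S \<longleftrightarrow>
     S \<subseteq> verts G \<and> (\<forall>p. maximal_geodesic G p \<longrightarrow> set p \<inter> S \<noteq> {})"

text \<open>
  Distinct lists in a packing are distinct as undirected paths: a path and its reversal share
  vertices, so they cannot both occur, and cardinalities below count undirected paths.
\<close>

definition geodesic_packing :: "('a,'b) pre_digraph \<Rightarrow> 'a list set \<Rightarrow> bool" where
  "geodesic_packing G P \<longleftrightarrow>
     (\<forall>p\<in>P. maximal_geodesic G p) \<and> pairwise (\<lambda>p q. set p \<inter> set q = {}) P"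

text \<open>
  For finite \<^term>\<open>G\<close> both sets of cardinalities are finite and nonempty: \<^term>\<open>verts G\<close> is
  a transversal and the empty set is a packing.
\<close>

definition gt :: "('a,'b) pre_digraph \<Rightarrow> nat" where
  "gt G = Min {card S |S. geodesic_transversal G S}"

definition gpack :: "('a,'b) pre_digraph \<Rightarrow> nat" where
  "gpack G = Max {card P |P. geodesic_packing G P}"

end

theory Submission
  imports Defs
begin

text \<open>A transversal S meets every path of a packing P. Choosing one vertex of S on each path
  gives a map from P to S, injective because the paths are pairwise disjoint; so |P| \<le> |S|
  (\<open>card_packing_le_card_transversal\<close>). Apply this to a largest packing and a smallest
  transversal; both exist since the graph is finite.\<close>

lemma maximal_geodesic_verts:
  assumes "maximal_geodesic G p"
  shows "p \<noteq> []" and "set p \<subseteq> verts G"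
  using assms by (auto simp: maximal_geodesic_def geodesic_def vpath_def vwalk_def)

text \<open>Serves twice: it shows that transversals exist, and, compared with an arbitrary packing,
  it bounds the size of every packing.\<close>

lemma geodesic_transversal_verts: "geodesic_transversal G (verts G)"
  unfolding geodesic_transversal_def
proof (intro conjI allI impI)
  fix p assume "maximal_geodesic G p"
  then have "p \<noteq> []" "set p \<subseteq> verts G" by (rule maximal_geodesic_verts)+
  then show "set p \<inter> verts G \<noteq> {}" by (simp add: Int_absorb2)
qed simp

lemma geodesic_packing_empty: "geodesic_packing G {}"
  by (simp add: geodesic_packing_def)

lemma card_packing_le_card_transversal:
  assumes "finite (verts G)" "geodesic_packing G P" "geodesic_transversal G S"
  shows "card P \<le> card S"
proof -
  have "\<forall>p\<in>P. \<exists>v. v \<in> set p \<inter> S"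
    using assms(2,3) unfolding geodesic_packing_def geodesic_transversal_def by blast
  then obtain f where f: "\<And>p. p \<in> P \<Longrightarrow> f p \<in> set p \<inter> S" by metis
  have "inj_on f P"
  proof (rule inj_onI, rule ccontr)
    fix p q assume pq: "p \<in> P" "q \<in> P" "f p = f q" "p \<noteq> q"
    then have "set p \<inter> set q = {}"
      using assms(2) by (auto simp: geodesic_packing_def pairwise_def)
    then show False using f[OF pq(1)] f[OF pq(2)] pq(3) by auto
  qed
  moreover have "f ` P \<subseteq> S" using f by blast
  \<comment> \<open>An infinite set has \<open>card\<close> 0, so injectivity alone would not
    compare the cardinalities.\<close>
  moreover have "finite S"
    using assms(1,3) unfolding geodesic_transversal_def by (blast intro: finite_subset)
  ultimately show ?thesis by (rule card_inj_on_le)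
qed

theorem mainTheorem2:
  fixes G :: "('a,'b) pre_digraph"
  assumes "graph G"
  shows "gt G \<ge> gpack G"
proof -
  interpret graph G by (rule assms)
  let ?T = "{card S |S. geodesic_transversal G S}"
  let ?P = "{card P |P. geodesic_packing G P}"
  note le = card_packing_le_card_transversal[OF finite_verts]
  \<comment> \<open>\<open>Min\<close> and \<open>Max\<close> are attained only on finite nonempty
    sets, so both properties are established for \<open>?T\<close> and \<open>?P\<close>.\<close>
  have "?T \<subseteq> {..card (verts G)}"
    by (auto simp: geodesic_transversal_def intro: card_mono)
  then have T: "finite ?T" "?T \<noteq> {}"
    using geodesic_transversal_verts by (blast intro: finite_subset)+
  \<comment> \<open>The bound is the comparison lemma with \<open>verts G\<close> as the
    transversal.\<close>
  have "?P \<subseteq> {..card (verts G)}"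
    using le[OF _ geodesic_transversal_verts] by auto
  then have P: "finite ?P" "?P \<noteq> {}"
    using geodesic_packing_empty by (blast intro: finite_subset)+
  have "Max ?P \<in> ?P" "Min ?T \<in> ?T"
    by (rule Max_in[OF P], rule Min_in[OF T])
  then show ?thesis
    unfolding gt_def gpack_def using le by auto
qed

end
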